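(* For every request sequence $\sigma$ and every algorithm $\textsc{Alg}$ (online or offline) serving $\sigma$ on a self-adjusting complete binary tree, $\mathrm{cost}(\textsc{Alg}(\sigma)) \ge WS(\sigma)/4$.
   Context: Self-adjusting complete tree model: a set $V$ of $n$ items is stored in a complete binary tree of $n$ servers, one item per server. Server depths are fixed, the root has depth $0$, and the depth of an item at a given time is the depth of the server hosting it. A request sequence $\sigma=(\sigma^{(1)},\sigma^{(2)},\dots,\sigma^{(m)})$ of items is served; all requests originate at the root. Serving request $\sigma^{(t)}$ incurs an access cost equal to the current depth of $\sigma^{(t)}$. The algorithm may reconfigure the tree by swaps, a swap exchanging the items hosted at a server and at its parent, at cost $1$ per swap (adjustment cost). The cost $\mathrm{cost}(\textsc{Alg}(\sigma))$ is the total access cost plus the total adjustment cost. The working set of an item $v$ at time $t$ is the set of distinct items requested since the last request of $v$ before time $t$, including $v$; the rank $v.\mathrm{rank}^{(t)}$ is the size of this working set. The working set bound is $WS(\sigma)=\sum_{t=1}^{m}\log\big(\sigma^{(t)}.\mathrm{rank}^{(t)}\big)$, with $\log$ to base $2$. *)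

theory Defs
  imports Complex_Main "HOL-Combinatorics.Transposition"
begin

(* A complete binary tree with n servers, in heap order: the servers are 1, ..., n, the root
   is 1, and the parent of s >= 2 is s div 2.  Thus n is arbitrary; every level is full except
   possibly the last, which is filled from the left. *)

fun server_depth :: "nat \<Rightarrow> nat" where
  "server_depth s = (if s \<le> 1 then 0 else Suc (server_depth (s div 2)))"

declare server_depth.simps [simp del]

(* A placement maps each item to the server hosting it. *)

type_synonym 'a placement = "'a \<Rightarrow> nat"

definition is_placement :: "'a set \<Rightarrow> 'a placement \<Rightarrow> bool" where
  "is_placement V p \<longleftrightarrow> bij_betw p V {1..card V}"

definition item_depth :: "'a placement \<Rightarrow> 'a \<Rightarrow> nat" where
  "item_depth p v = server_depth (p v)"

definition swap :: "nat \<Rightarrow> 'a placement \<Rightarrow> 'a placement" where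
  "swap s p = transpose s (s div 2) \<circ> p"

(* Given the initial placement and the whole request sequence, an algorithm returns for each t
   the list of swaps (each named by its child server) performed after the first t requests have
   been served and before the next one, if any.  Since the choice at t may depend on the whole
   sequence, this covers offline algorithms and, as a special case, online ones. *)

type_synonym 'a algorithm = "'a placement \<Rightarrow> 'a list \<Rightarrow> nat \<Rightarrow> nat list"

definition is_algorithm :: "'a set \<Rightarrow> 'a algorithm \<Rightarrow> bool" where
  "is_algorithm V alg \<longleftrightarrow>
     (\<forall>p \<sigma> t. is_placement V p \<longrightarrow> set \<sigma> \<subseteq> V \<longrightarrow> t \<le> length \<sigma> \<longrightarrow>
        set (alg p \<sigma> t) \<subseteq> {2..card V})"

(* Requests are numbered from 0, as list positions: request t is served in placement_at p sw t. *)

fun placement_at :: "'a placement \<Rightarrow> (nat \<Rightarrow> nat list) \<Rightarrow> nat \<Rightarrow> 'a placement" where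
  "placement_at p sw 0 = fold swap (sw 0) p"
| "placement_at p sw (Suc t) = fold swap (sw (Suc t)) (placement_at p sw t)"

definition access_cost :: "'a algorithm \<Rightarrow> 'a placement \<Rightarrow> 'a list \<Rightarrow> nat" where
  "access_cost alg p \<sigma> = (\<Sum>t<length \<sigma>. item_depth (placement_at p (alg p \<sigma>) t) (\<sigma> ! t))"

definition adjustment_cost :: "'a algorithm \<Rightarrow> 'a placement \<Rightarrow> 'a list \<Rightarrow> nat" where
  "adjustment_cost alg p \<sigma> = (\<Sum>t\<le>length \<sigma>. length (alg p \<sigma> t))"

definition cost :: "'a algorithm \<Rightarrow> 'a placement \<Rightarrow> 'a list \<Rightarrow> nat" where
  "cost alg p \<sigma> = access_cost alg p \<sigma> + adjustment_cost alg p \<sigma>"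

(* The items requested after the last request of v before position t, together with v.  If v has
   not been requested before, these are all items requested so far, together with v. *)

definition working_set :: "'a list \<Rightarrow> 'a \<Rightarrow> nat \<Rightarrow> 'a set" where
  "working_set \<sigma> v t = insert v {\<sigma> ! i | i. i < t \<and> (\<forall>j\<in>{i..<t}. \<sigma> ! j \<noteq> v)}"

definition rank :: "'a list \<Rightarrow> 'a \<Rightarrow> nat \<Rightarrow> nat" where
  "rank \<sigma> v t = card (working_set \<sigma> v t)"

definition working_set_bound :: "'a list \<Rightarrow> real" where
  "working_set_bound \<sigma> = (\<Sum>t<length \<sigma>. log 2 (real (rank \<sigma> (\<sigma> ! t) t)))"

end

theory Submission
  imports Defs
begin

text \<open>
  The proof is by a potential function. Let \<open>R\<close> be the positions of the items in a
  move-to-front list which is initially sorted by server number; then \<open>R v\<close> is at least the rank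
  of \<open>v\<close>. Item \<open>v\<close> at depth \<open>d\<close> contributes about \<open>max 0 (2 log (R v) - 4 d)\<close> to the potential,
  so it contributes only when it is much closer to the root than its position warrants. Initially
  this is \<open>0\<close>. A swap lifts one item by one level and increases the potential by at most \<open>4\<close>.
  When an item at position \<open>k\<close> and depth \<open>d\<close> is moved to the front, its own contribution drops
  to \<open>0\<close>, while the positions below \<open>k\<close> grow by one; an item at depth \<open>e\<close> is affected by
  that only if its position is at least \<open>4 ^ e\<close>, and then by \<open>O(1 / 4 ^ e)\<close>. As there are only
  \<open>2 ^ e\<close> such items, the total increase is bounded, and the constants work out to
  \<open>log k + \<Delta> \<le> 4 d\<close>.
\<close>

section \<open>Depths of servers\<close>

lemma server_depth_eqI: "2 ^ d \<le> s \<Longrightarrow> s < 2 ^ Suc d \<Longrightarrow> server_depth s = d"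
proof (induction d arbitrary: s)
  case 0
  then show ?case by (simp add: server_depth.simps)
next
  case (Suc d)
  have "2 \<le> s"
    using Suc.prems(1) one_le_power[of "2::nat" d] by (simp only: power_Suc) linarith
  moreover have "server_depth (s div 2) = d"
    using Suc.prems by (intro Suc.IH) auto
  ultimately show ?case
    by (simp add: server_depth.simps[of s])
qed

lemma less_two_power_Suc_server_depth: "s < 2 ^ Suc (server_depth s)"
proof (induction s rule: server_depth.induct)
  case (1 s)
  show ?case
  proof (cases "s \<le> 1")
    case True
    then show ?thesis by (simp add: server_depth.simps)
  next
    case False
    then have "s div 2 < 2 ^ Suc (server_depth (s div 2))"
      using 1 by simp
    then show ?thesis
      using False by (simp add: server_depth.simps[of s])
  qed
qed

lemma server_depth_eq_0_iff: "server_depth s = 0 \<longleftrightarrow> s \<le> 1"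
  by (simp add: server_depth.simps)

lemma server_depth_ge_2: "2 \<le> s \<Longrightarrow> server_depth s = Suc (server_depth (s div 2))"
  by (simp add: server_depth.simps[of s])

lemma sum_server_depth:
  fixes g :: "nat \<Rightarrow> real"
  shows "(\<Sum>s\<in>{1..<2 ^ m}. g (server_depth s)) = (\<Sum>d<m. 2 ^ d * g d)"
proof (induction m)
  case 0
  then show ?case by simp
next
  case (Suc m)
  have "{1..<2 ^ Suc m} = {1..<2 ^ m} \<union> {2 ^ m..<2 ^ Suc m :: nat}"
    by (intro ivl_disj_un_two(3)[symmetric]) auto
  then have "(\<Sum>s\<in>{1..<2 ^ Suc m}. g (server_depth s))
      = (\<Sum>s\<in>{1..<2 ^ m}. g (server_depth s)) + (\<Sum>s\<in>{2 ^ m..<2 ^ Suc m}. g (server_depth s))"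
    by (simp add: sum.union_disjoint)
  also have "(\<Sum>s\<in>{2 ^ m..<2 ^ Suc m}. g (server_depth s)) = (\<Sum>s\<in>{2 ^ m..<2 ^ Suc m :: nat}. g m)"
    by (intro sum.cong) (auto simp: server_depth_eqI)
  finally show ?case
    using Suc.IH by simp
qed

section \<open>The potential of an item\<close>

text \<open>
  Without the correction \<open>- 1\<close> at the root, the access to an item at depth \<open>1\<close> and position \<open>5\<close>
  would not be paid for when the item at position \<open>1\<close> is in the root and the one at position
  \<open>4\<close> is at depth \<open>1\<close>.
\<close>

definition pot :: "nat \<Rightarrow> nat \<Rightarrow> real" where
  "pot r d = max 0 (2 * log 2 (real r) - 4 * real d - (if d = 0 then 1 else 0))"

text \<open>Bounds the growth of \<open>pot r d\<close> when an access at position \<open>k\<close>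
  pushes position \<open>r < k\<close> back by one. The value at depth 1 is 2 log (5/4); from depth
  2 on, 2 log (1 + x) is at most 3 x with x = 1 / 4^d.\<close>

definition pot_inc :: "nat \<Rightarrow> nat \<Rightarrow> real" where
  "pot_inc k d = (if 4 ^ d < k
     then (if d = 0 then 6 / 5 else if d = 1 then 2 * (log 2 5 - 2) else 3 / 4 ^ d) else 0)"

lemma pot_nonneg: "0 \<le> pot r d"
  by (simp add: pot_def)

text \<open>
  The upper bound has to be this sharp: for positions above \<open>16\<close> the total increase
  \<open>6 / 5 + 4 * (log 2 5 - 2) + 3 / 2\<close> must not exceed \<open>4\<close>.
\<close>

lemma log2_five: "log 2 5 \<le> (72 / 31 :: real)" "2 \<le> log 2 (5::real)"
proof -
  \<comment> \<open>The fraction 72/31 lies between log 5 and 93/40, the largest value for which the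
    total is at most 4.\<close>
  have "31 * log 2 5 = log 2 ((5::real) ^ 31)"
    using log_nat_power[of 5 2 31] by (simp only: zero_less_numeral of_nat_numeral)
  also have "\<dots> \<le> log 2 (2 ^ 72)"
    by (subst log_le_cancel_iff) auto
  also have "\<dots> = 72"
    by (subst log_pow_cancel) auto
  finally show "log 2 5 \<le> (72 / 31 :: real)" by simp
  show "2 \<le> log 2 (5::real)"
    by (simp add: le_log_iff)
qed

text \<open>A form of e^2 \<le> 8, with (1 - 1/16)^32 standing in for e^(-2). It gives 1 / ln 2
  \<le> 3/2, hence the constant 3 in \<open>pot_inc\<close>.\<close>

lemma ln_two_ge: "2 / 3 \<le> ln (2::real)"
proof -
  have "- 3 * ln 2 = ln (1 / (2::real) ^ 3)"
    by (simp only: ln_div ln_realpow zero_less_power zero_less_numeral zero_less_one ln_one) simp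
  also have "\<dots> \<le> ln ((15 / 16) ^ 32)"
    by (subst ln_le_cancel_iff) (simp_all add: field_simps)
  also have "\<dots> = 32 * ln (15 / 16 :: real)"
    by (subst ln_realpow) simp_all
  also have "\<dots> \<le> 32 * (15 / 16 - 1)"
    by (intro mult_left_mono ln_le_minus_one) simp_all
  finally show ?thesis by simp
qed

lemma pot_inc_nonneg: "0 \<le> pot_inc k d"
  using log2_five by (simp add: pot_inc_def)

lemma log2_four_power: "log 2 (4 ^ d) = 2 * real d"
proof -
  have "(4::real) ^ d = 2 ^ (2 * d)"
    by (simp add: power_mult)
  then show ?thesis
    using log_pow_cancel[of "2::real" "2 * d"] by simp
qed

lemma pot_eq_0:
  assumes "1 \<le> r" "r \<le> 4 ^ d"
  shows "pot r d = 0"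
proof -
  have "log 2 (real r) \<le> log 2 (4 ^ d)"
    using assms by (subst log_le_cancel_iff) (auto simp flip: of_nat_le_iff)
  then show ?thesis
    by (simp add: pot_def log2_four_power)
qed

lemma pot_Suc_depth: "pot r (Suc d) \<le> pot r d" "pot r d \<le> pot r (Suc d) + 4"
  by (auto simp: pot_def)

lemma pot_Suc_le:
  assumes r: "1 \<le> r" "4 ^ d < Suc r"
  shows "pot (Suc r) d \<le> pot r d + 2 * log 2 (1 + 1 / real r)"
proof -
  have "1 + 1 / real r = real (Suc r) / real r"
    using r by (simp add: field_simps)
  then have "log 2 (1 + 1 / real r) = log 2 (real (Suc r)) - log 2 (real r)"
    using r by (simp add: log_divide)
  moreover have "0 \<le> log 2 (1 + 1 / real r)"
    by (subst zero_le_log_cancel_iff) (auto intro: add_pos_nonneg)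
  ultimately show ?thesis
    by (auto simp: pot_def)
qed

lemma pot_increase:
  assumes r: "1 \<le> r" "Suc r \<le> k"
  shows "pot (Suc r) d \<le> pot r d + pot_inc k d"
proof (cases "4 ^ d < Suc r")
  case False
  then have "pot (Suc r) d = 0"
    by (intro pot_eq_0) auto
  then show ?thesis
    using pot_nonneg[of r d] pot_inc_nonneg[of k d] by linarith
next
  case True
  have le: "pot (Suc r) d \<le> pot r d + 2 * log 2 (1 + 1 / x)" if "0 < x" "x \<le> real r" for x :: real
  proof -
    have "log 2 (1 + 1 / real r) \<le> log 2 (1 + 1 / x)"
      using that r by (subst log_le_cancel_iff) (auto intro: add_pos_nonneg simp: frac_le)
    then show ?thesis
      using pot_Suc_le[OF r(1) True] by linarith
  qed
  have four: "4 ^ d \<le> real r"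
    using True by (simp flip: of_nat_le_iff add: less_Suc_eq_le)
  have k: "4 ^ d < k"
    using True r by linarith
  consider "d = 0" "r = 1" | "d = 0" "2 \<le> r" | "d = 1" | "2 \<le> d"
    using r by linarith
  then show ?thesis
  proof cases
    \<comment> \<open>The correction at the root matters here: the contribution grows from 0 to 1,
      not by 2 log 2 = 2.\<close>
    case 1
    then show ?thesis
      using k by (simp add: pot_def pot_inc_def)
  next
    case 2
    \<comment> \<open>(3/2)^5 \<le> 8 yields 2 log (3/2) \<le> 6/5.\<close>
    have "5 * log 2 (3 / 2) = log 2 ((3 / 2 :: real) ^ 5)"
      using log_nat_power[of "3 / 2" 2 5] by (simp only: zero_less_numeral of_nat_numeral zero_less_divide_iff simp_thms)
    also have "\<dots> \<le> log 2 (2 ^ 3)"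
      by (subst log_le_cancel_iff) (auto simp: power_divide)
    also have "\<dots> = 3"
      by (subst log_pow_cancel) auto
    finally show ?thesis
      using 2 k le[of 2] by (simp add: pot_inc_def)
  next
    case 3
    have "log 2 (5 / 4 :: real) = log 2 5 - log 2 (4 ^ 1)"
      by (simp add: log_divide)
    also have "\<dots> = log 2 5 - 2"
      by (subst log2_four_power) simp
    finally show ?thesis
      using 3 k four le[of 4] by (simp add: pot_inc_def)
  next
    case 4
    define x where "x = 1 / (4::real) ^ d"
    have "ln 2 \<ge> (2 / 3 :: real)"
      by (rule ln_two_ge)
    moreover have x: "0 < x" by (simp add: x_def)
    ultimately have "x \<le> 3 / 2 * x * ln 2"
      using mult_left_mono[of "2 / 3" "ln 2" "3 / 2 * x"] by simp
    then have "ln (1 + x) \<le> 3 / 2 * x * ln 2"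
      using ln_add_one_self_le_self[of x] x by linarith
    then have "log 2 (1 + x) \<le> 3 / 2 * x"
      by (simp add: log_def divide_le_eq)
    then show ?thesis
      using 4 k four le[of "4 ^ d"] by (simp add: pot_inc_def x_def)
  qed
qed

text \<open>Level d has at most 2^d servers and counts only if 4^d < k, whence the thresholds 1, 4,
  16. From level 2 on, the terms 3 / 2^d form a geometric series with sum 3/2.\<close>

lemma sum_pot_inc_le:
  "(\<Sum>s\<in>{1..n}. pot_inc k (server_depth s))
     \<le> (if k \<le> 1 then 0 else if k \<le> 4 then 6 / 5 else if k \<le> 16 then 6 / 5 + 4 * (log 2 5 - 2)
        else 27 / 10 + 4 * (log 2 5 - 2))" (is "_ \<le> ?C")
proof -
  have tail: "(\<Sum>d<m. 2 ^ Suc (Suc d) * pot_inc k (Suc (Suc d))) \<le> (if k \<le> 16 then 0 else 3 / 2)" for m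
  proof (cases "k \<le> 16")
    case True
    have "pot_inc k (Suc (Suc d)) = 0" for d
    proof -
      have "16 \<le> (4::nat) ^ Suc (Suc d)"
        by simp
      then have "\<not> 4 ^ Suc (Suc d) < k"
        using True by linarith
      then show ?thesis
        by (simp only: pot_inc_def if_False)
    qed
    then show ?thesis by simp
  next
    case False
    have "(\<Sum>d<m. 2 ^ Suc (Suc d) * pot_inc k (Suc (Suc d))) \<le> (\<Sum>d<m. 3 / 4 * (1 / 2) ^ d)"
    proof (intro sum_mono)
      fix d
      have "(4::real) ^ d = 2 ^ d * 2 ^ d"
        by (simp flip: power_mult_distrib)
      then show "2 ^ Suc (Suc d) * pot_inc k (Suc (Suc d)) \<le> 3 / 4 * (1 / 2) ^ d"
        by (simp add: pot_inc_def power_divide)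
    qed
    also have "\<dots> = 3 / 2 * (1 - (1 / 2) ^ m)"
      by (simp only: sum_distrib_left[symmetric] sum_gp_strict) simp
    also have "\<dots> \<le> 3 / 2" by simp
    finally show ?thesis using False by simp
  qed
  have "n < 2 ^ n" by (rule less_exp)
  also have "(2::nat) ^ n \<le> 2 ^ Suc (Suc n)" by (rule power_increasing) auto
  finally have "{1..n} \<subseteq> {1..<2 ^ Suc (Suc n)}" by auto
  then have "(\<Sum>s\<in>{1..n}. pot_inc k (server_depth s))
      \<le> (\<Sum>s\<in>{1..<2 ^ Suc (Suc n)}. pot_inc k (server_depth s))"
    by (intro sum_mono2) (auto simp: pot_inc_nonneg)
  also have "\<dots> = (\<Sum>d<Suc (Suc n). 2 ^ d * pot_inc k d)"
    by (rule sum_server_depth)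
  also have "\<dots> = pot_inc k 0 + 2 * pot_inc k 1 + (\<Sum>d<n. 2 ^ Suc (Suc d) * pot_inc k (Suc (Suc d)))"
    by (simp only: sum.lessThan_Suc_shift) simp
  also have "\<dots> \<le> pot_inc k 0 + 2 * pot_inc k 1 + (if k \<le> 16 then 0 else 3 / 2)"
    using tail[of n] by simp
  also have "\<dots> \<le> ?C"
    by (auto simp: pot_inc_def)
  finally show ?thesis .
qed

text \<open>The accessed item is not pushed back, so its own \<open>pot_inc k d\<close> is
  subtracted. The right side is at least 2 log k, less 1 at the root, where the subtracted 6/5
  compensates. For k > 16 the total increase is at most 4 \<le> log k; for smaller k a deep item is
  paid for by 4 d alone.\<close>

lemma access_amortized:
  assumes k: "1 \<le> k"
  shows "log 2 (real k) + ((\<Sum>s\<in>{1..n}. pot_inc k (server_depth s)) - pot_inc k d)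
    \<le> 4 * real d + pot k d"
proof -
  define S where "S = (\<Sum>s\<in>{1..n}. pot_inc k (server_depth s))"
  note S = sum_pot_inc_le[of k n, folded S_def]
  have inc: "0 \<le> pot_inc k d" by (rule pot_inc_nonneg)
  have p: "0 \<le> pot k d" "2 * log 2 (real k) - 4 * real d - (if d = 0 then 1 else 0) \<le> pot k d"
    by (auto simp: pot_def)
  have log_ge: "log 2 (real j) \<le> log 2 (real k)" if "1 \<le> j" "j \<le> k" for j
    using that k by simp
  have log_le: "log 2 (real k) \<le> log 2 (real j)" if "k \<le> j" for j
    using that k by simp
  have logs: "log 2 4 = (2::real)" "log 2 16 = (4::real)"
    using log2_four_power[of 1] log2_four_power[of 2] by simp_all
  consider "k = 1" | "2 \<le> k" "k \<le> 4" | "5 \<le> k" "k \<le> 16" | "17 \<le> k"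
    using k by linarith
  then have "log 2 (real k) + (S - pot_inc k d) \<le> 4 * real d + pot k d"
  proof cases
    case 1
    then show ?thesis using S inc p by simp
  next
    case 2
    have "1 \<le> log 2 (real k)" "log 2 (real k) \<le> 2"
      using log_ge[of 2] log_le[of 4] 2 logs by auto
    moreover have "S \<le> 6 / 5" using S 2 by simp
    moreover have "d = 0 \<Longrightarrow> pot_inc k d = 6 / 5" using 2 by (simp add: pot_inc_def)
    moreover have "d = 0 \<or> 1 \<le> real d" by (cases d) auto
    ultimately show ?thesis using p inc by (auto split: if_splits)
  next
    case 3
    have "log 2 5 \<le> log 2 (real k)" "log 2 (real k) \<le> 4"
      using log_ge[of 5] log_le[of 16] 3 logs by auto
    moreover have "S \<le> 6 / 5 + 4 * (log 2 5 - 2)" using S 3 by simp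
    moreover have "d = 0 \<Longrightarrow> pot_inc k d = 6 / 5" "d = 1 \<Longrightarrow> pot_inc k d = 2 * (log 2 5 - 2)"
      using 3 by (simp_all add: pot_inc_def)
    moreover have "d = 0 \<or> d = 1 \<or> 2 \<le> real d" by linarith
    ultimately show ?thesis using p inc log2_five by (auto split: if_splits)
  next
    case 4
    have "4 \<le> log 2 (real k)"
      using log_ge[of 16] 4 logs by auto
    moreover have "S \<le> 27 / 10 + 4 * (log 2 5 - 2)" using S 4 by simp
    moreover have "d = 0 \<Longrightarrow> pot_inc k d = 6 / 5"
      using 4 by (simp add: pot_inc_def)
    ultimately show ?thesis using p inc log2_five by (auto split: if_splits)
  qed
  then show ?thesis by (simp add: S_def)
qed

section \<open>Move-to-front positions\<close>

definition to_front :: "'a \<Rightarrow> ('a \<Rightarrow> nat) \<Rightarrow> 'a \<Rightarrow> nat" where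
  "to_front v R u = (if u = v then 1 else if R u < R v then Suc (R u) else R u)"

definition mtf_pos :: "('a \<Rightarrow> nat) \<Rightarrow> 'a list \<Rightarrow> nat \<Rightarrow> 'a \<Rightarrow> nat" where
  "mtf_pos R \<sigma> t = fold to_front (take t \<sigma>) R"

lemma mtf_pos_0: "mtf_pos R \<sigma> 0 = R"
  by (simp add: mtf_pos_def)

lemma mtf_pos_Suc: "t < length \<sigma> \<Longrightarrow> mtf_pos R \<sigma> (Suc t) = to_front (\<sigma> ! t) (mtf_pos R \<sigma> t)"
  by (simp add: mtf_pos_def take_Suc_conv_app_nth)

text \<open>\<open>is_placement\<close> is reused for list positions: \<open>R\<close> numbers
  \<open>V\<close> from 1 to \<open>card V\<close>.\<close>

lemma is_placement_to_front:
  assumes R: "is_placement V R" and v: "v \<in> V"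
  shows "is_placement V (to_front v R)"
proof -
  have inj: "inj_on R V" and img: "R ` V = {1..card V}"
    using R by (auto simp: is_placement_def bij_betw_def)
  have bnd: "1 \<le> R u" "R u \<le> card V" if "u \<in> V" for u
    using img that by auto
  have "inj_on (to_front v R) V"
  proof (rule inj_onI)
    fix x y assume xy: "x \<in> V" "y \<in> V" "to_front v R x = to_front v R y"
    have "to_front v R u = 1 \<longleftrightarrow> u = v" if "u \<in> V" for u
    proof (cases "u = v")
      case False
      then have "R u \<noteq> R v" using that inj v by (auto dest: inj_onD)
      then show ?thesis using False bnd(1)[OF that] bnd(1)[OF v] by (simp add: to_front_def)
    qed (simp add: to_front_def)
    then have "x = v \<longleftrightarrow> y = v" using xy by metis
    moreover have "x = y" if "x \<noteq> v" "y \<noteq> v"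
    proof -
      have "R x \<noteq> R v" "R y \<noteq> R v" using that inj xy v by (auto dest: inj_onD)
      then have "R x = R y" using that xy(3) by (simp add: to_front_def split: if_splits)
      then show ?thesis using inj xy by (auto dest: inj_onD)
    qed
    ultimately show "x = y" by blast
  qed
  moreover have "to_front v R ` V \<subseteq> {1..card V}"
  proof (rule image_subsetI)
    fix u assume "u \<in> V"
    then show "to_front v R u \<in> {1..card V}"
      using bnd[of u] bnd[of v] v by (auto simp: to_front_def)
  qed
  ultimately show ?thesis
    by (simp add: is_placement_def bij_betw_def card_subset_eq card_image)
qed

lemma is_placement_mtf_pos:
  assumes "is_placement V R" "set \<sigma> \<subseteq> V" "t \<le> length \<sigma>"
  shows "is_placement V (mtf_pos R \<sigma> t)"
  using assms(3)
proof (induction t)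
  case 0
  then show ?case using assms by (simp add: mtf_pos_0)
next
  case (Suc t)
  then have "\<sigma> ! t \<in> V" using assms(2) by (simp add: subset_code(1))
  then show ?case using Suc by (simp add: mtf_pos_Suc is_placement_to_front)
qed

lemma working_set_Suc:
  "working_set \<sigma> v (Suc t) = (if \<sigma> ! t = v then {v} else insert (\<sigma> ! t) (working_set \<sigma> v t))"
proof (cases "\<sigma> ! t = v")
  case True
  then show ?thesis by (auto simp: working_set_def less_Suc_eq_le)
next
  case False
  have "(i < Suc t \<and> (\<forall>j\<in>{i..<Suc t}. \<sigma> ! j \<noteq> v)) \<longleftrightarrow> i = t \<or> (i < t \<and> (\<forall>j\<in>{i..<t}. \<sigma> ! j \<noteq> v))" for i
    using False by (auto simp: less_Suc_eq)
  then show ?thesis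
    using False unfolding working_set_def by (auto simp del: Ball_def)
qed

text \<open>An item requested since the last request of \<open>v\<close> was moved ahead of
  \<open>v\<close>, and only a request of \<open>v\<close> can bring \<open>v\<close> past it
  again.\<close>

lemma working_set_subset_mtf_pos:
  assumes "is_placement V R" "set \<sigma> \<subseteq> V" "v \<in> V" "t \<le> length \<sigma>"
  shows "working_set \<sigma> v t \<subseteq> {u \<in> V. mtf_pos R \<sigma> t u \<le> mtf_pos R \<sigma> t v}"
  using assms(4)
proof (induction t)
  case 0
  then show ?case using assms(3) by (simp add: working_set_def)
next
  case (Suc t)
  have V: "\<sigma> ! t \<in> V" using assms(2) Suc.prems by (simp add: subset_code(1))
  have "1 \<le> mtf_pos R \<sigma> t v"
    using is_placement_mtf_pos[OF assms(1,2), of t] Suc.prems assms(3)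
    by (auto simp: is_placement_def bij_betw_def)
  then show ?case
    using Suc V assms(3)
    by (force simp: working_set_Suc mtf_pos_Suc to_front_def)
qed

lemma rank_le_mtf_pos:
  assumes "is_placement V R" "set \<sigma> \<subseteq> V" "v \<in> V" "t \<le> length \<sigma>"
  shows "rank \<sigma> v t \<le> mtf_pos R \<sigma> t v"
proof -
  let ?m = "mtf_pos R \<sigma> t"
  have bij: "bij_betw ?m V {1..card V}"
    using is_placement_mtf_pos[OF assms(1,2,4)] by (simp add: is_placement_def)
  have "inj_on ?m (working_set \<sigma> v t)" "?m ` working_set \<sigma> v t \<subseteq> {1..?m v}"
    using working_set_subset_mtf_pos[OF assms] bij
    by (fastforce simp: bij_betw_def intro: inj_on_subset)+
  then show ?thesis
    using card_inj_on_le[of ?m "working_set \<sigma> v t" "{1..?m v}"] by (simp add: rank_def)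
qed

lemma rank_pos: "1 \<le> rank \<sigma> v t"
proof -
  have "finite (working_set \<sigma> v t)"
    by (simp add: working_set_def)
  then show ?thesis
    by (auto simp: rank_def Suc_le_eq card_gt_0_iff working_set_def)
qed

section \<open>The total potential\<close>

definition total_pot :: "'a set \<Rightarrow> ('a \<Rightarrow> nat) \<Rightarrow> 'a placement \<Rightarrow> real" where
  "total_pot V R q = (\<Sum>v\<in>V. pot (R v) (item_depth q v))"

lemma total_pot_nonneg: "0 \<le> total_pot V R q"
  by (simp add: total_pot_def sum_nonneg pot_nonneg)

text \<open>With server numbers as list positions, an item at depth d \<ge> 1 has position below
  2^(d+1) \<le> 4^d. That inequality fails at the root, but there the position is 1.\<close>

lemma total_pot_initial:
  assumes "is_placement V p"
  shows "total_pot V p p = 0"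
  unfolding total_pot_def
proof (intro sum.neutral ballI)
  fix v assume "v \<in> V"
  then have 1: "1 \<le> p v" using assms by (auto simp: is_placement_def bij_betw_def)
  let ?d = "server_depth (p v)"
  have "p v \<le> 4 ^ ?d"
  proof (cases "?d = 0")
    case True
    then have "p v \<le> 1" by (simp only: server_depth_eq_0_iff)
    also have "1 \<le> (4::nat) ^ ?d" by simp
    finally show ?thesis .
  next
    case False
    have "p v < 2 ^ Suc ?d" by (rule less_two_power_Suc_server_depth)
    also have "\<dots> \<le> 2 ^ (2 * ?d)" using False by (intro power_increasing) auto
    also have "\<dots> = 4 ^ ?d" by (simp add: power_mult)
    finally show ?thesis by simp
  qed
  then show "pot (p v) (item_depth p v) = 0"
    using 1 by (simp add: item_depth_def pot_eq_0)
qed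

lemma is_placement_swap:
  assumes "is_placement V q" "s \<in> {2..card V}"
  shows "is_placement V (swap s q)"
proof -
  have "s \<in> {1..card V}" "s div 2 \<in> {1..card V}" using assms(2) by auto
  then have "bij_betw (transpose s (s div 2)) {1..card V} {1..card V}"
    by (simp add: bij_betw_transpose_iff)
  then show ?thesis
    using assms(1) unfolding is_placement_def swap_def by (rule bij_betw_trans[rotated])
qed

text \<open>Only the item in the child server \<open>s\<close> rises; the item moving down can only
  lose potential.\<close>

lemma total_pot_swap:
  assumes "finite V" "is_placement V q" "2 \<le> s"
  shows "total_pot V R (swap s q) \<le> total_pot V R q + 4"
proof -
  have inj: "inj_on q V" using assms(2) by (simp add: is_placement_def bij_betw_def)
  have "pot (R v) (item_depth (swap s q) v)
      \<le> pot (R v) (item_depth q v) + (if q v = s then 4 else 0)" for v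
    using server_depth_ge_2[OF assms(3)] pot_Suc_depth[of "R v" "server_depth (s div 2)"]
    by (auto simp: item_depth_def swap_def transpose_def)
  then have "total_pot V R (swap s q) \<le> total_pot V R q + (\<Sum>v\<in>V. if q v = s then 4 else 0)"
    unfolding total_pot_def sum.distrib[symmetric] by (intro sum_mono)
  also have "(\<Sum>v\<in>V. if q v = s then 4 else (0::real)) = (\<Sum>x\<in>q ` V. if x = s then 4 else 0)"
    using inj by (simp add: sum.reindex)
  also have "\<dots> \<le> 4"
    using assms(1) by simp
  finally show ?thesis by simp
qed

lemma fold_swap:
  assumes "finite V" "is_placement V q" "set ss \<subseteq> {2..card V}"
  shows "is_placement V (fold swap ss q) \<and>
    total_pot V R (fold swap ss q) \<le> total_pot V R q + 4 * real (length ss)"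
  using assms(2,3)
proof (induction ss arbitrary: q)
  case Nil
  then show ?case by simp
next
  case (Cons s ss)
  then have "is_placement V (swap s q)" by (intro is_placement_swap) auto
  then have "is_placement V (fold swap ss (swap s q)) \<and>
      total_pot V R (fold swap ss (swap s q)) \<le> total_pot V R (swap s q) + 4 * real (length ss)"
    using Cons by simp
  moreover have "total_pot V R (swap s q) \<le> total_pot V R q + 4"
    using Cons.prems assms(1) by (intro total_pot_swap) auto
  ultimately show ?case by auto
qed

text \<open>The contribution of \<open>v\<close> drops to 0 at position 1. The increases of the
  other items are summed over servers instead of items, so that \<open>access_amortized\<close>
  applies.\<close>

lemma total_pot_access:
  assumes V: "finite V" and R: "is_placement V R" and q: "is_placement V q" and v: "v \<in> V"
  shows "log 2 (real (R v)) + total_pot V (to_front v R) q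
    \<le> total_pot V R q + 4 * real (item_depth q v)"
proof -
  let ?k = "R v" and ?d = "item_depth q v"
  have R1: "1 \<le> R u" if "u \<in> V" for u
    using R that by (auto simp: is_placement_def bij_betw_def)
  have "pot (to_front v R u) (item_depth q u) \<le> pot (R u) (item_depth q u) + pot_inc ?k (item_depth q u)"
    if "u \<in> V - {v}" for u
    using that R1[of u] pot_increase[of "R u" ?k] pot_inc_nonneg by (auto simp: to_front_def)
  then have "(\<Sum>u\<in>V - {v}. pot (to_front v R u) (item_depth q u))
      \<le> (\<Sum>u\<in>V - {v}. pot (R u) (item_depth q u)) + (\<Sum>u\<in>V - {v}. pot_inc ?k (item_depth q u))"
    unfolding sum.distrib[symmetric] by (intro sum_mono)
  moreover have "(\<Sum>u\<in>V. pot_inc ?k (item_depth q u)) = (\<Sum>s\<in>{1..card V}. pot_inc ?k (server_depth s))"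
    using q unfolding is_placement_def item_depth_def by (rule sum.reindex_bij_betw)
  moreover have "pot (to_front v R v) ?d = 0"
    by (simp add: to_front_def pot_eq_0)
  ultimately show ?thesis
    using access_amortized[OF R1[OF v], of "card V" ?d] unfolding total_pot_def
    by (simp add: sum.remove[OF V v])
qed

theorem theorem1:
  fixes V :: "'a set" and alg :: "'a algorithm" and p :: "'a placement" and \<sigma> :: "'a list"
  assumes "finite V"
    and "is_algorithm V alg"
    and "is_placement V p"
    and "set \<sigma> \<subseteq> V"
  shows "real (cost alg p \<sigma>) \<ge> working_set_bound \<sigma> / 4"
proof -
  define sw where "sw = alg p \<sigma>"
  define q where "q = placement_at p sw"
  define R where "R = mtf_pos p \<sigma>"
  have sw: "set (sw t) \<subseteq> {2..card V}" if "t \<le> length \<sigma>" for t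
    using assms that by (auto simp: is_algorithm_def sw_def)
  \<comment> \<open>State just before request \<open>t\<close>: the swaps of round \<open>t\<close>
    are already made and paid for, so the adjustment sum includes \<open>t\<close> while the other
    sums stop before it.\<close>
  have "is_placement V (q t) \<and>
      (\<Sum>i<t. log 2 (real (rank \<sigma> (\<sigma> ! i) i))) + total_pot V (R t) (q t)
      \<le> 4 * (\<Sum>i<t. real (item_depth (q i) (\<sigma> ! i))) + 4 * (\<Sum>i\<le>t. real (length (sw i)))"
    if "t \<le> length \<sigma>" for t
    using that
  proof (induction t)
    case 0
    then show ?case
      using fold_swap[OF assms(1,3) sw, of 0 p] total_pot_initial[OF assms(3)]
      by (simp add: q_def R_def mtf_pos_0)
  next
    case (Suc t)
    let ?v = "\<sigma> ! t"
    have v: "?v \<in> V" using assms(4) Suc.prems by (simp add: subset_code(1))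
    have q: "is_placement V (q t)" using Suc by simp
    have "real (rank \<sigma> ?v t) \<le> real (R t ?v)"
      using rank_le_mtf_pos[OF assms(3,4) v, of t] Suc.prems by (simp add: R_def)
    then have "log 2 (real (rank \<sigma> ?v t)) \<le> log 2 (real (R t ?v))"
      using rank_pos[of \<sigma> ?v t] by (subst log_le_cancel_iff) auto
    moreover have "log 2 (real (R t ?v)) + total_pot V (R (Suc t)) (q t)
        \<le> total_pot V (R t) (q t) + 4 * real (item_depth (q t) ?v)"
      using total_pot_access[OF assms(1) _ q v, of "R t"] is_placement_mtf_pos[OF assms(3,4), of t]
        Suc.prems by (simp add: R_def mtf_pos_Suc)
    moreover have "is_placement V (q (Suc t)) \<and> total_pot V (R (Suc t)) (q (Suc t))
        \<le> total_pot V (R (Suc t)) (q t) + 4 * real (length (sw (Suc t)))"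
      using fold_swap[OF assms(1) q sw[OF Suc.prems], of "R (Suc t)"] by (simp add: q_def)
    ultimately show ?case
      using Suc by auto
  qed
  \<comment> \<open>At \<open>t = length \<sigma>\<close> the swaps after the last request are
    included, as in \<open>adjustment_cost\<close>.\<close>
  from this[OF order.refl] have "working_set_bound \<sigma> + total_pot V (R (length \<sigma>)) (q (length \<sigma>))
      \<le> 4 * real (cost alg p \<sigma>)"
    by (simp add: working_set_bound_def cost_def access_cost_def adjustment_cost_def q_def sw_def)
  then show ?thesis
    using total_pot_nonneg[of V "R (length \<sigma>)" "q (length \<sigma>)"] by linarith
qed

end
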